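(* Let $r\ge 1$, let $s\ge 2$ be even, and let $k=rs\ge 2$. Let $G(8,2)$ be the graph obtained from $s$ disjoint copies of $C(8,2)$, indexed $1,\dots,s$, by merging, for each $1\le i\le s/2$, the vertex $z$ of copy $i$ with the vertex $u_4$ of copy $s/2+i$, and the vertex $z$ of copy $s/2+i$ with the vertex $u_4$ of copy $i$. Then $\chi_{la}(rG(8,2))=3$.
   Context: For a graph $G=(V,E)$ with $|E|=m$ and no isolated vertices, a local antimagic labeling is a bijection $f:E\to\{1,\dots,m\}$ such that $f^+(u)\ne f^+(v)$ for every edge $uv$, where $f^+(x)=\sum f(e)$ over all edges $e$ incident to $x$. The local antimagic chromatic number $\chi_{la}(G)$ is the minimum, over all local antimagic labelings $f$ of $G$, of the number of distinct values taken by $f^+$ (also for disconnected graphs). $rG$ is the disjoint union of $r$ copies of $G$. Merging vertices means identifying them into one vertex incident to all edges previously incident to any of them. $C(8,2)$ is the graph with vertices $u_1,\dots,u_7,z$ consisting of the 8-cycle $u_1u_2\cdots u_7zu_1$ together with the extra edges $zu_2$ and $zu_6$ (equivalently: an 8-cycle $u_1\cdots u_8u_1$ plus a vertex $x$ adjacent to $u_2,u_6$, with $x$ and $u_8$ then merged into $z$). *)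

theory Defs
  imports Main "HOL-Library.Extended_Nat"
begin

text \<open>
  A graph is a pair of a vertex set and a set of edges, each edge being the two-element set of its
  end points. All graphs considered below are finite, simple and without isolated vertices.
\<close>

type_synonym 'v graph = "'v set \<times> 'v set set"

abbreviation verts :: "'v graph \<Rightarrow> 'v set" where
  "verts G \<equiv> fst G"

abbreviation edges :: "'v graph \<Rightarrow> 'v set set" where
  "edges G \<equiv> snd G"

definition vertex_sum :: "'v graph \<Rightarrow> ('v set \<Rightarrow> nat) \<Rightarrow> 'v \<Rightarrow> nat" where
  "vertex_sum G f x = (\<Sum>e\<in>{e \<in> edges G. x \<in> e}. f e)"

definition local_antimagic :: "'v graph \<Rightarrow> ('v set \<Rightarrow> nat) \<Rightarrow> bool" where
  "local_antimagic G f \<longleftrightarrow>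
     bij_betw f (edges G) {1..card (edges G)} \<and>
     (\<forall>u v. {u, v} \<in> edges G \<longrightarrow> vertex_sum G f u \<noteq> vertex_sum G f v)"

text \<open>
  The minimum is taken in \<^typ>\<open>enat\<close>, so that it is \<open>\<infinity>\<close>
  for a graph without any local antimagic labeling.
\<close>

definition chi_la :: "'v graph \<Rightarrow> enat" where
  "chi_la G = (INF f\<in>{f. local_antimagic G f}. enat (card (vertex_sum G f ` verts G)))"

text \<open>Disjoint copies of a graph, indexed by the elements of \<open>I\<close>.\<close>

definition copies :: "nat set \<Rightarrow> 'v graph \<Rightarrow> (nat \<times> 'v) graph" where
  "copies I G = (I \<times> verts G, {Pair i ` e | i e. i \<in> I \<and> e \<in> edges G})"

text \<open>
  Merging the two vertices of each pair in \<open>R\<close>: the new vertices are the classes of the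
  equivalence relation generated by \<open>R\<close>. Since edges are sets, no loops or parallel edges
  can be recorded: this is vertex identification only if no edge lies within a class and no
  two distinct edges join the same two classes.
\<close>

definition merge_class :: "('v \<times> 'v) set \<Rightarrow> 'v \<Rightarrow> 'v set" where
  "merge_class R v = (R \<union> R\<inverse>)\<^sup>* `` {v}"

definition merge :: "('v \<times> 'v) set \<Rightarrow> 'v graph \<Rightarrow> 'v set graph" where
  "merge R G = (merge_class R ` verts G, (\<lambda>e. merge_class R ` e) ` edges G)"

datatype c82_vertex = U nat | Z

definition C82 :: "c82_vertex graph" where
  "C82 =
    (U ` {1..7} \<union> {Z},
     {{U j, U (j + 1)} | j. 1 \<le> j \<and> j \<le> 6} \<union> {{U 7, Z}, {Z, U 1}} \<union> {{Z, U 2}, {Z, U 6}})"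

text \<open>
  No edges collapse here: \<open>Z\<close> and \<open>U 4\<close> are not adjacent in \<^const>\<open>C82\<close>, and the two
  vertices of each merged pair lie in different copies. The result has \<open>7 * s\<close> vertices and
  \<open>10 * s\<close> edges.
\<close>

definition G82 :: "nat \<Rightarrow> (nat \<times> c82_vertex) set graph" where
  "G82 s =
    merge
      ({((i, Z), (s div 2 + i, U 4)) | i. 1 \<le> i \<and> i \<le> s div 2} \<union>
       {((s div 2 + i, Z), (i, U 4)) | i. 1 \<le> i \<and> i \<le> s div 2})
      (copies {1..s} C82)"

end

(*
  The triangle z u_1 u_2 forces three vertex sums. Conversely, number the k copies of C(8,2) by
  j = 1, ..., k and label the edges of copy j by the linear functions of j in "label" below.
  In every copy the two edges at u_1, u_3, u_5, u_7 add up to 8k + 1, the three edges at u_2, u_6 add up to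
  14k + 2, the four edges at z to 32k + 2 and the two edges at u_4 to 8k, all independently of j.
  So it does not matter which z is merged with which u_4: the merged vertex has sum 40k + 2.
*)

theory Submission
  imports Defs
begin

section \<open>Vertex sums\<close>

text \<open>With an injective naming of the edges by indices, incidence sums run over indices, so
  edges that are sets of merge classes need not be enumerated.\<close>

lemma vertex_sum_reindex:
  assumes "edges G = E ` J" and "inj_on E J" and "\<And>j. j \<in> J \<Longrightarrow> f (E j) = l j"
  shows "vertex_sum G f x = sum l {j \<in> J. x \<in> E j}"
proof -
  have eq: "{e \<in> edges G. x \<in> e} = E ` {j \<in> J. x \<in> E j}"
    using assms(1) by auto
  have inj: "inj_on E {j \<in> J. x \<in> E j}"
    using assms(2) by (rule inj_on_subset) auto
  show ?thesis
    unfolding vertex_sum_def eq sum.reindex[OF inj] using assms(3) by (auto intro: sum.cong)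
qed

lemma triangle_imp_three_le_chi_la:
  assumes "finite (verts G)" and "{x, y, z} \<subseteq> verts G"
    and "{x, y} \<in> edges G" "{y, z} \<in> edges G" "{x, z} \<in> edges G"
  shows "3 \<le> chi_la G"
  unfolding chi_la_def
\<comment> \<open>Without any local antimagic labeling the infimum is infinite, and the bound still
  holds.\<close>
proof (rule INF_greatest)
  fix f assume "f \<in> {f. local_antimagic G f}"
  then have "vertex_sum G f x \<noteq> vertex_sum G f y" "vertex_sum G f y \<noteq> vertex_sum G f z"
    "vertex_sum G f x \<noteq> vertex_sum G f z"
    using assms(3-5) by (auto simp: local_antimagic_def)
  then have "card (vertex_sum G f ` {x, y, z}) = 3"
    by simp
  moreover have "card (vertex_sum G f ` {x, y, z}) \<le> card (vertex_sum G f ` verts G)"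
    using assms(1,2) by (intro card_mono finite_imageI image_mono)
  ultimately have "3 \<le> card (vertex_sum G f ` verts G)"
    by simp
  then have "enat 3 \<le> enat (card (vertex_sum G f ` verts G))"
    by simp
  then show "3 \<le> enat (card (vertex_sum G f ` verts G))"
    by (simp add: numeral_eq_enat)
qed

section \<open>The edges of \<open>C(8,2)\<close> and their labels\<close>

text \<open>Names for the ten edges, so that claims about edges become finite case analyses. The
  orientation by \<open>tail\<close> and \<open>head\<close> is arbitrary.\<close>

datatype arc = A12 | A23 | A34 | A45 | A56 | A67 | A7Z | AZ1 | AZ2 | AZ6

lemma UNIV_arc: "UNIV = {A12, A23, A34, A45, A56, A67, A7Z, AZ1, AZ2, AZ6}"
  using arc.exhaust by auto

fun tail :: "arc \<Rightarrow> c82_vertex" where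
  "tail A12 = U 1" | "tail A23 = U 2" | "tail A34 = U 3" | "tail A45 = U 4" | "tail A56 = U 5"
| "tail A67 = U 6" | "tail A7Z = U 7" | "tail AZ1 = Z" | "tail AZ2 = Z" | "tail AZ6 = Z"

fun head :: "arc \<Rightarrow> c82_vertex" where
  "head A12 = U 2" | "head A23 = U 3" | "head A34 = U 4" | "head A45 = U 5" | "head A56 = U 6"
| "head A67 = U 7" | "head A7Z = Z" | "head AZ1 = U 1" | "head AZ2 = U 2" | "head AZ6 = U 6"

lemma verts_C82: "verts C82 = {U 1, U 2, U 3, U 4, U 5, U 6, U 7, Z}"
proof -
  have "{1..7::nat} = {1, 2, 3, 4, 5, 6, 7}"
    by auto
  then show ?thesis
    by (auto simp: C82_def)
qed

lemma edges_C82: "edges C82 = range (\<lambda>t. {tail t, head t})"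
proof -
  have "{1..6::nat} = {1, 2, 3, 4, 5, 6}"
    by auto
  moreover have "{{U j, U (j + 1)} | j. 1 \<le> j \<and> j \<le> 6} = (\<lambda>j. {U j, U (j + 1)}) ` {1..6}"
    by auto
  ultimately have "{{U j, U (j + 1)} | j. 1 \<le> j \<and> j \<le> 6} =
      {{U 1, U 2}, {U 2, U 3}, {U 3, U 4}, {U 4, U 5}, {U 5, U 6}, {U 6, U 7}}"
    by (simp add: eval_nat_numeral)
  then show ?thesis
    unfolding C82_def UNIV_arc by auto
qed

lemma ends_in_C82: "tail t \<in> verts C82" "head t \<in> verts C82"
  unfolding verts_C82 by (cases t; simp)+

text \<open>As j runs through 1..k, \<open>A12\<close>, \<open>A67\<close>, \<open>A7Z\<close>,
  \<open>AZ1\<close>, \<open>AZ2\<close>, \<open>AZ6\<close> fill the blocks of length k ending at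
  k, 2k, 7k, 8k, 9k, 10k. \<open>A34\<close> and \<open>A56\<close> share 2k+1..4k, while
  \<open>A45\<close> and \<open>A23\<close> share 4k+1..6k, odd labels going to the first of each
  pair and even labels to the second.\<close>

fun label :: "nat \<Rightarrow> nat \<Rightarrow> arc \<Rightarrow> nat" where
  "label k j A12 = j"
| "label k j AZ1 = 8 * k + 1 - j"
| "label k j A23 = 6 * k + 2 - 2 * j"
| "label k j A34 = 2 * k + 2 * j - 1"
| "label k j AZ2 = 8 * k + j"
| "label k j A67 = 2 * k + 1 - j"
| "label k j A7Z = 6 * k + j"
| "label k j A56 = 2 * k + 2 * j"
| "label k j A45 = 6 * k + 1 - 2 * j"
| "label k j AZ6 = 10 * k + 1 - j"

text \<open>Arcs with different blocks are separated by linear inequalities; parity separates the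
  two arcs that share a block.\<close>

lemma label_inject:
  assumes "j \<in> {1..k}" "j' \<in> {1..k}" "label k j t = label k j' t'"
  shows "j = j' \<and> t = t'"
proof -
  have parity: "even (label k i t) \<longleftrightarrow> t \<in> {A23, A56}"
    if "t \<in> {A23, A34, A45, A56}" "i \<in> {1..k}" for i t
    using that by auto
  have "t \<in> {A23, A56} \<longleftrightarrow> t' \<in> {A23, A56}"
    if "t \<in> {A23, A34, A45, A56}" "t' \<in> {A23, A34, A45, A56}"
    using parity[OF that(1) assms(1)] parity[OF that(2) assms(2)] assms(3) by simp
  with assms show ?thesis
    by (cases t; cases t'; simp; linarith)
qed

lemma label_range:
  assumes "j \<in> {1..k}"
  shows "label k j t \<in> {1..10 * k}"
  using assms by (cases t) auto

definition copy_no :: "nat \<Rightarrow> nat \<Rightarrow> nat \<Rightarrow> nat" where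
  "copy_no s p i = (p - 1) * s + i"

lemma copy_no_range:
  assumes "p \<in> {1..r}" "i \<in> {1..s}"
  shows "copy_no s p i \<in> {1..r * s}"
proof -
  have "(p - 1) * s + i \<le> (p - 1) * s + s"
    using assms by simp
  also have "\<dots> = p * s"
    using assms by (simp add: algebra_simps)
  also have "\<dots> \<le> r * s"
    using assms by simp
  finally show ?thesis
    using assms by (simp add: copy_no_def)
qed

lemma copy_no_inject:
  assumes "p \<ge> 1" "p' \<ge> 1" "i \<in> {1..s}" "i' \<in> {1..s}" "copy_no s p i = copy_no s p' i'"
  shows "p = p' \<and> i = i'"
proof -
  \<comment> \<open>Shifting i to start at 0 makes it a remainder modulo s, so \<open>div\<close>
    and \<open>mod\<close> recover both indices.\<close>
  have eq: "(p - 1) * s + (i - 1) = (p' - 1) * s + (i' - 1)"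
    using assms by (simp add: copy_no_def)
  have lt: "i - 1 < s" "i' - 1 < s"
    using assms by auto
  have "p - 1 = p' - 1"
    using arg_cong[OF eq, of "\<lambda>x. x div s"] lt by simp
  moreover have "i - 1 = i' - 1"
    using arg_cong[OF eq, of "\<lambda>x. x mod s"] lt by simp
  ultimately show ?thesis
    using assms by auto
qed

lemma bij_betw_label:
  "bij_betw (\<lambda>(p, i, t). label (r * s) (copy_no s p i) t) ({1..r} \<times> {1..s} \<times> UNIV) {1..10 * (r * s)}"
    (is "bij_betw ?l ?J _")
proof -
  have inj: "inj_on ?l ?J"
  proof (rule inj_onI)
    fix x y
    assume *: "x \<in> ?J" "y \<in> ?J" "?l x = ?l y"
    obtain p i t p' i' t' where xy: "x = (p, i, t)" "y = (p', i', t')"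
      by (metis prod_cases3)
    with * have range: "p \<in> {1..r}" "i \<in> {1..s}" "p' \<in> {1..r}" "i' \<in> {1..s}"
      by auto
    have "copy_no s p i = copy_no s p' i' \<and> t = t'"
      using *(3) unfolding xy prod.case
      by (rule label_inject[OF copy_no_range[OF range(1,2)] copy_no_range[OF range(3,4)]])
    then show "x = y"
      using copy_no_inject[of p p' i s i'] range unfolding xy by auto
  qed
  have "?l ` ?J \<subseteq> {1..10 * (r * s)}"
    using label_range copy_no_range by fast
  moreover have "card ?J = 10 * (r * s)"
    by (simp add: card_cartesian_product UNIV_arc)
  \<comment> \<open>An injective map between finite sets of equal size is onto.\<close>
  ultimately have "?l ` ?J = {1..10 * (r * s)}"
    using inj by (intro card_subset_eq) (auto simp: card_image)
  with inj show ?thesis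
    by (simp add: bij_betw_def)
qed

section \<open>The merged graph\<close>

text \<open>The only step from v leads to \<open>\<tau> v\<close>, and the next one leads back, so
  the closure stops after one step.\<close>

lemma merge_class_involution:
  assumes "R \<union> R\<inverse> = (\<lambda>u. (u, \<tau> u)) ` D" and "\<And>u. u \<in> D \<Longrightarrow> \<tau> (\<tau> u) = u"
  shows "merge_class R v = (if v \<in> D then {v, \<tau> v} else {v})"
proof -
  have "w = v \<or> v \<in> D \<and> w = \<tau> v" if "(v, w) \<in> (R \<union> R\<inverse>)\<^sup>*" for w
    using that by induction (use assms in auto)
  moreover have "(v, \<tau> v) \<in> (R \<union> R\<inverse>)\<^sup>*" if "v \<in> D"
    using that assms(1) by (intro r_into_rtrancl) blast
  ultimately show ?thesis
    by (auto simp: merge_class_def)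
qed

lemma edges_copies:
  assumes "edges G = E ` J"
  shows "edges (copies I G) = (\<lambda>(i, j). Pair i ` E j) ` (I \<times> J)"
  unfolding copies_def snd_conv assms by auto

definition partner :: "nat \<Rightarrow> nat \<Rightarrow> nat" where
  "partner s i = (if i \<le> s div 2 then s div 2 + i else i - s div 2)"

lemma partner_range:
  assumes "even s" "i \<in> {1..s}"
  shows "partner s i \<in> {1..s}"
  using assms by (auto simp: partner_def)

lemma partner_partner:
  assumes "even s" "i \<in> {1..s}"
  shows "partner s (partner s i) = i"
  using assms by (auto simp: partner_def)

text \<open>The merge class of (i, v) in closed form, for even s and i in range; see
  \<open>merge_class_merged_pairs\<close>.\<close>

definition node :: "nat \<Rightarrow> nat \<Rightarrow> c82_vertex \<Rightarrow> (nat \<times> c82_vertex) set" where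
  "node s i v =
    (if v = Z then {(i, Z), (partner s i, U 4)}
     else if v = U 4 then {(i, U 4), (partner s i, Z)}
     else {(i, v)})"

lemma node_eq_iff:
  assumes "even s" "i \<in> {1..s}" "i' \<in> {1..s}"
  shows "node s i v = node s i' v' \<longleftrightarrow>
    i = i' \<and> v = v' \<or> i' = partner s i \<and> (v = Z \<and> v' = U 4 \<or> v = U 4 \<and> v' = Z)"
  using partner_partner[OF assms(1,2)] partner_partner[OF assms(1,3)]
  by (auto simp: node_def doubleton_eq_iff)

definition merged_pairs :: "nat \<Rightarrow> ((nat \<times> c82_vertex) \<times> (nat \<times> c82_vertex)) set" where
  "merged_pairs s =
    {((i, Z), (s div 2 + i, U 4)) | i. 1 \<le> i \<and> i \<le> s div 2} \<union>
    {((s div 2 + i, Z), (i, U 4)) | i. 1 \<le> i \<and> i \<le> s div 2}"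

lemma G82_eq: "G82 s = merge (merged_pairs s) (copies {1..s} C82)"
  by (simp add: G82_def merged_pairs_def)

lemma merge_class_merged_pairs:
  assumes "even s" "i \<in> {1..s}"
  shows "merge_class (merged_pairs s) (i, v) = node s i v"
proof -
  define \<tau> where "\<tau> = (\<lambda>(i, v). (partner s i, if v = Z then U 4 else Z))"
  define D where "D = {1..s} \<times> {Z, U 4}"
  obtain h where h: "s = 2 * h"
    using \<open>even s\<close> by auto
  have halves: "{1..s} = {1..h} \<union> (\<lambda>i. h + i) ` {1..h}"
    unfolding h by (auto simp: image_iff)
  \<comment> \<open>The four images are the first and second components of the two families of
    merged pairs; on each of them \<open>partner\<close> just adds or subtracts h.\<close>
  have D: "D = (\<lambda>i. (i, Z)) ` {1..h} \<union> (\<lambda>i. (h + i, Z)) ` {1..h} \<union>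
      (\<lambda>i. (i, U 4)) ` {1..h} \<union> (\<lambda>i. (h + i, U 4)) ` {1..h}"
    unfolding D_def halves by blast
  have "merged_pairs s \<union> (merged_pairs s)\<inverse> = (\<lambda>u. (u, \<tau> u)) ` D"
    unfolding D merged_pairs_def h \<tau>_def partner_def by (auto simp: image_Un image_image)
  moreover have "\<tau> (\<tau> u) = u" if "u \<in> D" for u
    using that partner_partner[OF \<open>even s\<close>] by (auto simp: \<tau>_def D_def)
  ultimately have "merge_class (merged_pairs s) (i, v) =
      (if (i, v) \<in> D then {(i, v), \<tau> (i, v)} else {(i, v)})"
    by (rule merge_class_involution)
  then show ?thesis
    using assms(2) by (auto simp: \<tau>_def D_def node_def)
qed

definition link :: "nat \<Rightarrow> nat \<times> nat \<times> arc \<Rightarrow> (nat \<times> (nat \<times> c82_vertex) set) set" where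
  "link s = (\<lambda>(p, i, t). {(p, node s i (tail t)), (p, node s i (head t))})"

lemma verts_copies_G82:
  assumes "even s"
  shows "verts (copies I (G82 s)) =
    (\<lambda>(p, i, v). (p, node s i v)) ` (I \<times> {1..s} \<times> verts C82)"
proof -
  have G: "verts (G82 s) = (\<lambda>(i, v). node s i v) ` ({1..s} \<times> verts C82)"
    unfolding G82_eq merge_def copies_def fst_conv
    by (rule image_cong) (auto simp: merge_class_merged_pairs[OF assms])
  show ?thesis
    unfolding copies_def fst_conv G by force
qed

lemma edges_copies_G82:
  assumes "even s"
  shows "edges (copies I (G82 s)) = link s ` (I \<times> {1..s} \<times> UNIV)"
proof -
  have "edges (G82 s) = (\<lambda>(i, t). {node s i (tail t), node s i (head t)}) ` ({1..s} \<times> UNIV)"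
    unfolding G82_eq merge_def snd_conv edges_copies[OF edges_C82] image_image
    by (rule image_cong) (auto simp: merge_class_merged_pairs[OF assms])
  from edges_copies[OF this] show ?thesis
    by (simp add: link_def case_prod_unfold)
qed

text \<open>Merging creates no parallel edges: every arc has an end other than \<open>Z\<close> and
  \<open>U 4\<close>, whose singleton class fixes the copy, and no vertex is adjacent to both
  \<open>Z\<close> and \<open>U 4\<close>.\<close>

lemma inj_on_link:
  assumes "even s"
  shows "inj_on (link s) (I \<times> {1..s} \<times> UNIV)"
proof (rule inj_onI)
  fix x y
  assume *: "x \<in> I \<times> {1..s} \<times> UNIV" "y \<in> I \<times> {1..s} \<times> UNIV" "link s x = link s y"
  obtain p i t p' i' t' where xy: "x = (p, i, t)" "y = (p', i', t')"
    by (metis prod_cases3)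
  with * have "i \<in> {1..s}" "i' \<in> {1..s}" "link s (p, i, t) = link s (p', i', t')"
    by auto
  then show "x = y"
    unfolding xy by (cases t; cases t'; simp add: link_def doubleton_eq_iff node_eq_iff[OF assms])
qed

section \<open>Vertex sums of the labeling and the value of \<open>chi_la\<close>\<close>

fun colour :: "nat \<Rightarrow> c82_vertex \<Rightarrow> nat" where
  "colour k Z = 40 * k + 2"
| "colour k (U n) = (if n = 4 then 40 * k + 2 else if n \<in> {2, 6} then 14 * k + 2 else 8 * k + 1)"

text \<open>The three classes {z, u_4}, {u_2, u_6} and {u_1, u_3, u_5, u_7} are independent sets,
  and their colours differ once k is positive.\<close>

lemma colour_ends: "k \<ge> 1 \<Longrightarrow> colour k (tail t) \<noteq> colour k (head t)"
  by (cases t) auto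

lemma sum_label_at_node:
  assumes "even s" "p \<in> {1..r}" "i \<in> {1..s}" "v \<in> verts C82"
  shows "(\<Sum>(p', i', t) \<in> {x \<in> {1..r} \<times> {1..s} \<times> UNIV. (p, node s i v) \<in> link s x}.
      label (r * s) (copy_no s p' i') t) = colour (r * s) v"
proof -
  define inc where
    "inc i v = {x \<in> {1..r} \<times> {1..s} \<times> UNIV. (p, node s i v) \<in> link s x}" for i v
  have mem: "(p', i', t) \<in> inc i v \<longleftrightarrow> p' = p \<and> i' \<in> {1..s} \<and>
      (node s i v = node s i' (tail t) \<or> node s i v = node s i' (head t))" for i v p' i' t
    using assms(2) by (auto simp: inc_def link_def)
  \<comment> \<open>Copy numbers between 1 and r * s keep the subtractions in \<open>label\<close>
    from truncating.\<close>
  note range = copy_no_range[OF assms(2)]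
  note iff = node_eq_iff[OF assms(1)]
  \<comment> \<open>An unmerged vertex meets only arcs of its own copy; the sum over all ten arcs
    with a conditional then evaluates directly.\<close>
  have deg2_3: "(\<Sum>(p', i', t) \<in> inc i (U n). label (r * s) (copy_no s p' i') t) = colour (r * s) (U n)"
    if n: "n \<in> {1, 2, 3, 5, 6, 7}" for n
  proof -
    have "inc i (U n) = (\<lambda>t. (p, i, t)) ` {t. U n \<in> {tail t, head t}}"
      using n assms(3) by (auto simp: mem iff)
    then have "(\<Sum>(p', i', t) \<in> inc i (U n). label (r * s) (copy_no s p' i') t) =
        (\<Sum>t | t \<in> UNIV \<and> U n \<in> {tail t, head t}. label (r * s) (copy_no s p i) t)"
      by (simp only: UNIV_I simp_thms) (subst sum.reindex; simp add: inj_on_def)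
    also have "\<dots> = (\<Sum>t\<in>UNIV. if U n \<in> {tail t, head t} then label (r * s) (copy_no s p i) t else 0)"
      by (rule sum.inter_filter) (simp add: UNIV_arc)
    also have "\<dots> = colour (r * s) (U n)"
      using n range[OF assms(3)] by (auto simp: UNIV_arc)
    finally show ?thesis .
  qed
  \<comment> \<open>Four arcs come from z in copy i, with sum 32k + 2, and two from u_4 in the
    partner copy, with sum 8k, where k = r * s.\<close>
  have deg6: "(\<Sum>(p', i', t) \<in> inc i Z. label (r * s) (copy_no s p' i') t) = 40 * (r * s) + 2"
    if i: "i \<in> {1..s}" for i
  proof -
    have "(p', i', t) \<in> inc i Z \<longleftrightarrow> (p', i', t) \<in> {(p, i, A7Z), (p, i, AZ1), (p, i, AZ2), (p, i, AZ6),
        (p, partner s i, A34), (p, partner s i, A45)}" for p' i' t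
    proof (cases "i' \<in> {1..s}")
      case True
      show ?thesis
        using i partner_range[OF assms(1) i] True by (cases t) (auto simp: mem iff[OF i True])
    next
      case False
      then show ?thesis
        using i partner_range[OF assms(1) i] by (auto simp: mem)
    qed
    then have "inc i Z = {(p, i, A7Z), (p, i, AZ1), (p, i, AZ2), (p, i, AZ6),
        (p, partner s i, A34), (p, partner s i, A45)}"
      by (intro set_eqI) (metis prod_cases3)
    then show ?thesis
      using range[OF i] range[OF partner_range[OF assms(1) i]] by simp
  qed
  \<comment> \<open>The case of u_4 is the previous one under the other name of the merged
    vertex.\<close>
  have "node s i (U 4) = node s (partner s i) Z"
    using assms partner_range by (simp add: iff partner_partner)
  then have "inc i (U 4) = inc (partner s i) Z"
    by (simp add: inc_def)
  then show ?thesis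
    using assms(4) deg2_3 deg6[OF assms(3)] deg6[OF partner_range[OF assms(1,3)]]
    unfolding verts_C82 inc_def[symmetric] by auto
qed

theorem theorem4p6:
  fixes r s k :: nat
  assumes "r \<ge> 1"
    and "s \<ge> 2" and "even s"
    and "k = r * s" and "k \<ge> 2"
  shows "chi_la (copies {1..r} (G82 s)) = 3"
proof (rule antisym)
  define G where "G = copies {1..r} (G82 s)"
  define J where "J = {1..r} \<times> {1..s} \<times> (UNIV :: arc set)"
  define l where "l = (\<lambda>(p, i, t). label k (copy_no s p i) t)"
  \<comment> \<open>The labels of index triples, carried over to the edges along the inverse of
    \<open>link\<close>.\<close>
  define f where "f = l \<circ> inv_into J (link s)"
  have V: "verts G = (\<lambda>(p, i, v). (p, node s i v)) ` ({1..r} \<times> {1..s} \<times> verts C82)"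
    unfolding G_def by (rule verts_copies_G82[OF \<open>even s\<close>])
  have E: "edges G = link s ` J"
    unfolding G_def J_def by (rule edges_copies_G82[OF \<open>even s\<close>])
  have inj: "inj_on (link s) J"
    unfolding J_def by (rule inj_on_link[OF \<open>even s\<close>])
  have l: "bij_betw l J {1..10 * k}"
    unfolding l_def J_def \<open>k = r * s\<close> by (rule bij_betw_label)
  have vs: "vertex_sum G f (p, node s i v) = colour k v"
    if "p \<in> {1..r}" "i \<in> {1..s}" "v \<in> verts C82" for p i v
    using vertex_sum_reindex[OF E inj, of f l] inj
      sum_label_at_node[OF \<open>even s\<close> that]
    by (simp add: f_def l_def J_def \<open>k = r * s\<close>)
  have "card (edges G) = 10 * k"
    using bij_betw_same_card[OF l] by (simp add: E card_image inj)
  moreover have "bij_betw f (edges G) {1..10 * k}"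
    unfolding f_def E using inj l
    by (intro bij_betw_trans[OF _ l] bij_betw_inv_into) (simp add: bij_betw_def)
  moreover have "vertex_sum G f u \<noteq> vertex_sum G f v" if "{u, v} \<in> edges G" for u v
  proof -
    from that obtain p i t where pi: "p \<in> {1..r}" "i \<in> {1..s}" and "{u, v} = link s (p, i, t)"
      by (auto simp: E J_def)
    then have "u = (p, node s i (tail t)) \<and> v = (p, node s i (head t)) \<or>
        v = (p, node s i (tail t)) \<and> u = (p, node s i (head t))"
      by (auto simp: link_def doubleton_eq_iff)
    then show ?thesis
      using vs[OF pi] ends_in_C82 colour_ends[of k t] \<open>k \<ge> 2\<close> by (auto dest: sym)
  qed
  ultimately have "local_antimagic G f"
    by (simp add: local_antimagic_def)
  then have "chi_la G \<le> enat (card (vertex_sum G f ` verts G))"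
    unfolding chi_la_def by (intro INF_lower) simp
  also have "card (vertex_sum G f ` verts G) \<le> card {40 * k + 2, 14 * k + 2, 8 * k + 1}"
  proof (rule card_mono)
    have "colour k v \<in> {40 * k + 2, 14 * k + 2, 8 * k + 1}" for v
      by (cases v) auto
    then show "vertex_sum G f ` verts G \<subseteq> {40 * k + 2, 14 * k + 2, 8 * k + 1}"
      unfolding V using vs by force
  qed simp
  also have "\<dots> \<le> 3"
    by (simp add: card_insert_if)
  finally show "chi_la (copies {1..r} (G82 s)) \<le> 3"
    by (simp add: G_def numeral_eq_enat)

  have "finite (verts G)"
    unfolding V by (simp add: verts_C82)
  moreover have "(1, node s 1 v) \<in> verts G" if "v \<in> verts C82" for v
    unfolding V using that \<open>r \<ge> 1\<close> \<open>s \<ge> 2\<close> by (intro image_eqI[of _ _ "(1, 1, v)"]) auto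
  then have "{(1, node s 1 (U 1)), (1, node s 1 (U 2)), (1, node s 1 Z)} \<subseteq> verts G"
    by (simp add: verts_C82)
  moreover have "link s (1, 1, t) \<in> edges G" for t
    unfolding E J_def using assms by simp
  \<comment> \<open>These arcs form the triangle u_1 u_2 z of the first copy, which survives the
    merging.\<close>
  from this[of A12] this[of AZ2] this[of AZ1]
  have "{(1, node s 1 (U 1)), (1, node s 1 (U 2))} \<in> edges G"
    "{(1, node s 1 (U 2)), (1, node s 1 Z)} \<in> edges G"
    "{(1, node s 1 (U 1)), (1, node s 1 Z)} \<in> edges G"
    by (simp_all add: link_def) (simp_all add: insert_commute)
  ultimately show "3 \<le> chi_la (copies {1..r} (G82 s))"
    unfolding G_def by (rule triangle_imp_three_le_chi_la)
qed

end
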